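(* Let $\mathcal{H}$ be a complex Hilbert space and let $\Omega$ be a sesquilinear form on a dense subspace $\mathcal{D}$ of $\mathcal{H}$. Then $\Omega$ is closed in the sense of McIntosh if and only if it is solvable with respect to (the norm induced by) an inner product on $\mathcal{D}$ and $-\lambda\iota\in\mathfrak{P}(\Omega)$ for some $\lambda\in\mathbb{C}$.
   Context: Let $\langle\cdot|\cdot\rangle$ and $\|\cdot\|$ be the inner product and norm of $\mathcal{H}$; $\iota(\xi,\eta)=\langle\xi|\eta\rangle$. Sesquilinear forms are linear in the first variable and conjugate linear in the second. A form $\Omega$ with dense domain $\mathcal{D}$ is closed in the sense of McIntosh if: (1) $\mathcal{D}$ is a Hilbert space with an inner product $\langle\cdot|\cdot\rangle_\Omega$; (2) the embedding $\mathcal{D}[\langle\cdot|\cdot\rangle_\Omega]\hookrightarrow\mathcal{H}$ is continuous; (3) $\Omega$ is bounded in $\mathcal{D}[\langle\cdot|\cdot\rangle_\Omega]$; (4) there exist $\lambda\in\mathbb{C}$ and a bijective bounded operator $C$ on the Hilbert space $\mathcal{D}[\langle\cdot|\cdot\rangle_\Omega]$ such that $(\Omega-\lambda\iota)(\xi,\eta)=\langle C\xi|\eta\rangle_\Omega$ for all $\xi,\eta\in\mathcal{D}$. A sesquilinear form $\Omega$ on the dense subspace $\mathcal{D}$ is q-closed with respect to a norm $\|\cdot\|_\Omega$ on $\mathcal{D}$ if: (1) there is $\alpha>0$ with $\|\xi\|\le\alpha\|\xi\|_\Omega$ for all $\xi\in\mathcal{D}$; (2) if $\{\xi_n\}\subset\mathcal{D}$,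 $\|\xi_n\|\to0$ and $\|\xi_n-\xi_m\|_\Omega\to0$, then $\|\xi_n\|_\Omega\to0$; (3) $\mathcal{E}_\Omega:=\mathcal{D}[\|\cdot\|_\Omega]$ is a reflexive Banach space; (4) there is $\beta>0$ with $|\Omega(\xi,\eta)|\le\beta\|\xi\|_\Omega\|\eta\|_\Omega$ for all $\xi,\eta\in\mathcal{D}$. Let $\mathcal{E}_\Omega^\times$ be the conjugate dual of $\mathcal{E}_\Omega$ (bounded conjugate linear functionals). $\mathfrak{P}(\Omega)$ is the set of bounded sesquilinear forms $\Upsilon$ on $\mathcal{H}$ such that (i) if $\xi\in\mathcal{D}$ and $(\Omega+\Upsilon)(\xi,\eta)=0$ for all $\eta\in\mathcal{D}$, then $\xi=0$; (ii) for every $\Lambda\in\mathcal{E}_\Omega^\times$ there is $\xi\in\mathcal{D}$ with $\Lambda(\eta)=(\Omega+\Upsilon)(\xi,\eta)$ for all $\eta\in\mathcal{D}$. $\Omega$ is solvable with respect to $\|\cdot\|_\Omega$ if it is q-closed with respect to $\|\cdot\|_\Omega$ and $\mathfrak{P}(\Omega)\neq\varnothing$; it is solvable with respect to an inner product if it is solvable with respect to the norm induced by that inner product. *)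

theory Defs
  imports "HOL-Analysis.Analysis" "HOL-Library.Function_Algebras"
begin

section \<open>Complex Hilbert spaces\<close>

class scaleC =
  fixes scaleC :: "complex \<Rightarrow> 'a \<Rightarrow> 'a"  (infixr "*\<^sub>C" 75)

class complex_vector = scaleC + ab_group_add +
  assumes scaleC_add_right: "a *\<^sub>C (x + y) = a *\<^sub>C x + a *\<^sub>C y"
    and scaleC_add_left: "(a + b) *\<^sub>C x = a *\<^sub>C x + b *\<^sub>C x"
    and scaleC_scaleC: "a *\<^sub>C (b *\<^sub>C x) = (a * b) *\<^sub>C x"
    and scaleC_one: "1 *\<^sub>C x = x"

global_interpretation complex_vector:
  vector_space "scaleC :: complex \<Rightarrow> 'a \<Rightarrow> 'a::complex_vector"
  by unfold_locales
    (simp_all add: scaleC_add_right scaleC_add_left scaleC_scaleC scaleC_one)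

text \<open>The inner product is linear in the first and conjugate linear in the second argument.
  The triangle inequality contained in \<^class>\<open>real_normed_vector\<close> is redundant; the class is
  used so that the topological notions of the library apply.\<close>

class complex_inner = complex_vector + real_normed_vector +
  fixes cinner :: "'a \<Rightarrow> 'a \<Rightarrow> complex"
  assumes scaleR_scaleC: "r *\<^sub>R x = complex_of_real r *\<^sub>C x"
    and cinner_commute: "cinner y x = cnj (cinner x y)"
    and cinner_add_left: "cinner (x + y) z = cinner x z + cinner y z"
    and cinner_scaleC_left: "cinner (c *\<^sub>C x) y = c * cinner x y"
    and cinner_ge_zero: "0 \<le> Re (cinner x x)"
    and cinner_eq_zero_iff: "cinner x x = 0 \<longleftrightarrow> x = 0"
    and norm_eq_sqrt_cinner: "norm x = sqrt (Re (cinner x x))"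

class chilbert_space = complex_inner + complete_space

instantiation complex :: chilbert_space
begin

definition scaleC_complex_def: "scaleC (c::complex) (x::complex) = c * x"

definition cinner_complex_def: "cinner (x::complex) y = x * cnj y"

instance
proof
  fix a b c x y z :: complex and r :: real
  show "a *\<^sub>C (x + y) = a *\<^sub>C x + a *\<^sub>C y" "(a + b) *\<^sub>C x = a *\<^sub>C x + b *\<^sub>C x"
    "a *\<^sub>C (b *\<^sub>C x) = (a * b) *\<^sub>C x" "1 *\<^sub>C x = x"
    by (simp_all add: scaleC_complex_def algebra_simps)
  show "r *\<^sub>R x = complex_of_real r *\<^sub>C x"
    by (simp add: scaleC_complex_def scaleR_conv_of_real)
  show "cinner y x = cnj (cinner x y)" "cinner (x + y) z = cinner x z + cinner y z"
    "cinner (c *\<^sub>C x) y = c * cinner x y" "cinner x x = 0 \<longleftrightarrow> x = 0"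
    by (simp_all add: cinner_complex_def scaleC_complex_def algebra_simps)
  show "0 \<le> Re (cinner x x)" "norm x = sqrt (Re (cinner x x))"
    by (simp_all add: cinner_complex_def cmod_def power2_eq_square)
qed

end

instantiation "fun" :: (type, complex_vector) complex_vector
begin

definition scaleC_fun_def: "scaleC c f = (\<lambda>x. c *\<^sub>C f x)"

instance
  by standard
    (simp_all add: scaleC_fun_def fun_eq_iff scaleC_add_right scaleC_add_left
      scaleC_scaleC scaleC_one)

end


section \<open>Linear, conjugate linear and sesquilinear maps on a subspace\<close>

text \<open>Spaces whose norm or inner product is not the ambient one are given by a carrier
  \<open>D\<close>, meant to be a complex subspace, together with a function giving the norm or inner product.
  Values outside of \<open>D\<close> are irrelevant.\<close>

definition clinear_on :: "'a::complex_vector set \<Rightarrow> ('a \<Rightarrow> 'b::complex_vector) \<Rightarrow> bool" where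
  "clinear_on D f \<longleftrightarrow>
     (\<forall>x\<in>D. \<forall>y\<in>D. f (x + y) = f x + f y) \<and> (\<forall>c. \<forall>x\<in>D. f (c *\<^sub>C x) = c *\<^sub>C f x)"

definition antilinear_on :: "'a::complex_vector set \<Rightarrow> ('a \<Rightarrow> 'b::complex_vector) \<Rightarrow> bool" where
  "antilinear_on D f \<longleftrightarrow>
     (\<forall>x\<in>D. \<forall>y\<in>D. f (x + y) = f x + f y) \<and> (\<forall>c. \<forall>x\<in>D. f (c *\<^sub>C x) = cnj c *\<^sub>C f x)"

definition sesquilinear_on :: "'a::complex_vector set \<Rightarrow> ('a \<Rightarrow> 'a \<Rightarrow> complex) \<Rightarrow> bool" where
  "sesquilinear_on D \<Omega> \<longleftrightarrow>
     (\<forall>\<eta>\<in>D. clinear_on D (\<lambda>\<xi>. \<Omega> \<xi> \<eta>)) \<and> (\<forall>\<xi>\<in>D. antilinear_on D (\<Omega> \<xi>))"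


section \<open>Normed spaces and inner product spaces on a subspace\<close>

definition norm_on :: "'a::complex_vector set \<Rightarrow> ('a \<Rightarrow> real) \<Rightarrow> bool" where
  "norm_on D N \<longleftrightarrow>
     (\<forall>x\<in>D. 0 \<le> N x) \<and> (\<forall>x\<in>D. N x = 0 \<longleftrightarrow> x = 0) \<and>
     (\<forall>c. \<forall>x\<in>D. N (c *\<^sub>C x) = cmod c * N x) \<and>
     (\<forall>x\<in>D. \<forall>y\<in>D. N (x + y) \<le> N x + N y)"

text \<open>The metric is made total because the locale \<^locale>\<open>Metric_space\<close> requires nonnegativity
  and symmetry also outside of its carrier.\<close>

definition norm_dist :: "'a::complex_vector set \<Rightarrow> ('a \<Rightarrow> real) \<Rightarrow> 'a \<Rightarrow> 'a \<Rightarrow> real" where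
  "norm_dist D N x y = (if x \<in> D \<and> y \<in> D then N (x - y) else 0)"

definition banach_on :: "'a::complex_vector set \<Rightarrow> ('a \<Rightarrow> real) \<Rightarrow> bool" where
  "banach_on D N \<longleftrightarrow>
     complex_vector.subspace D \<and> norm_on D N \<and> Metric_space.mcomplete D (norm_dist D N)"

definition inner_product_on :: "'a::complex_vector set \<Rightarrow> ('a \<Rightarrow> 'a \<Rightarrow> complex) \<Rightarrow> bool" where
  "inner_product_on D ip \<longleftrightarrow>
     sesquilinear_on D ip \<and> (\<forall>x\<in>D. \<forall>y\<in>D. ip y x = cnj (ip x y)) \<and>
     (\<forall>x\<in>D. 0 \<le> Re (ip x x)) \<and> (\<forall>x\<in>D. ip x x = 0 \<longleftrightarrow> x = 0)"

definition ip_norm :: "('a \<Rightarrow> 'a \<Rightarrow> complex) \<Rightarrow> 'a \<Rightarrow> real" where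
  "ip_norm ip x = sqrt (Re (ip x x))"

definition hilbert_on :: "'a::complex_vector set \<Rightarrow> ('a \<Rightarrow> 'a \<Rightarrow> complex) \<Rightarrow> bool" where
  "hilbert_on D ip \<longleftrightarrow>
     complex_vector.subspace D \<and> inner_product_on D ip \<and>
     Metric_space.mcomplete D (norm_dist D (ip_norm ip))"

definition bounded_form_on ::
    "'a::complex_vector set \<Rightarrow> ('a \<Rightarrow> real) \<Rightarrow> ('a \<Rightarrow> 'a \<Rightarrow> complex) \<Rightarrow> bool" where
  "bounded_form_on D N \<Omega> \<longleftrightarrow>
     (\<exists>\<beta>>0. \<forall>\<xi>\<in>D. \<forall>\<eta>\<in>D. cmod (\<Omega> \<xi> \<eta>) \<le> \<beta> * N \<xi> * N \<eta>)"

definition bounded_operator_on ::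
    "'a::complex_vector set \<Rightarrow> ('a \<Rightarrow> real) \<Rightarrow> ('a \<Rightarrow> 'a) \<Rightarrow> bool" where
  "bounded_operator_on D N C \<longleftrightarrow>
     C ` D \<subseteq> D \<and> clinear_on D C \<and> (\<exists>K. \<forall>\<xi>\<in>D. N (C \<xi>) \<le> K * N \<xi>)"


section \<open>Duals and reflexivity\<close>

text \<open>Functionals on \<open>D\<close> are normalised to vanish outside of \<open>D\<close>, so that each functional is
  represented by exactly one function and the dual is a complex subspace of the function type.\<close>

definition dual_on :: "'a::complex_vector set \<Rightarrow> ('a \<Rightarrow> real) \<Rightarrow> ('a \<Rightarrow> complex) set" where
  "dual_on D N =
     {f. clinear_on D f \<and> (\<exists>K. \<forall>x\<in>D. cmod (f x) \<le> K * N x) \<and> (\<forall>x. x \<notin> D \<longrightarrow> f x = 0)}"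

definition conj_dual_on :: "'a::complex_vector set \<Rightarrow> ('a \<Rightarrow> real) \<Rightarrow> ('a \<Rightarrow> complex) set" where
  "conj_dual_on D N =
     {f. antilinear_on D f \<and> (\<exists>K. \<forall>x\<in>D. cmod (f x) \<le> K * N x) \<and> (\<forall>x. x \<notin> D \<longrightarrow> f x = 0)}"

definition dual_norm :: "'a::complex_vector set \<Rightarrow> ('a \<Rightarrow> real) \<Rightarrow> ('a \<Rightarrow> complex) \<Rightarrow> real" where
  "dual_norm D N f = (SUP x\<in>{x\<in>D. N x \<le> 1}. cmod (f x))"

definition reflexive_on :: "'a::complex_vector set \<Rightarrow> ('a \<Rightarrow> real) \<Rightarrow> bool" where
  "reflexive_on D N \<longleftrightarrow>
     (\<forall>F\<in>dual_on (dual_on D N) (dual_norm D N). \<exists>x\<in>D. \<forall>f\<in>dual_on D N. F f = f x)"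


section \<open>Closed, q-closed and solvable forms\<close>

definition mcintosh_closed ::
    "'a::complex_inner set \<Rightarrow> ('a \<Rightarrow> 'a \<Rightarrow> complex) \<Rightarrow> bool" where
  "mcintosh_closed D \<Omega> \<longleftrightarrow>
     (\<exists>ip. hilbert_on D ip \<and>
        continuous_map (Metric_space.mtopology D (norm_dist D (ip_norm ip))) euclidean (\<lambda>\<xi>. \<xi>) \<and>
        bounded_form_on D (ip_norm ip) \<Omega> \<and>
        (\<exists>lam C. bounded_operator_on D (ip_norm ip) C \<and> bij_betw C D D \<and>
           (\<forall>\<xi>\<in>D. \<forall>\<eta>\<in>D. \<Omega> \<xi> \<eta> - lam * cinner \<xi> \<eta> = ip (C \<xi>) \<eta>)))"

definition q_closed ::
    "'a::complex_inner set \<Rightarrow> ('a \<Rightarrow> real) \<Rightarrow> ('a \<Rightarrow> 'a \<Rightarrow> complex) \<Rightarrow> bool" where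
  "q_closed D N \<Omega> \<longleftrightarrow>
     (\<exists>\<alpha>>0. \<forall>\<xi>\<in>D. norm \<xi> \<le> \<alpha> * N \<xi>) \<and>
     (\<forall>X. Metric_space.MCauchy D (norm_dist D N) X \<and> (\<lambda>n. norm (X n)) \<longlonglongrightarrow> 0
        \<longrightarrow> (\<lambda>n. N (X n)) \<longlonglongrightarrow> 0) \<and>
     banach_on D N \<and> reflexive_on D N \<and>
     bounded_form_on D N \<Omega>"

definition perturbations ::
    "'a::complex_inner set \<Rightarrow> ('a \<Rightarrow> real) \<Rightarrow> ('a \<Rightarrow> 'a \<Rightarrow> complex) \<Rightarrow> ('a \<Rightarrow> 'a \<Rightarrow> complex) set" where
  "perturbations D N \<Omega> =
     {\<Upsilon>. sesquilinear_on UNIV \<Upsilon> \<and> bounded_form_on UNIV norm \<Upsilon> \<and>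
        (\<forall>\<xi>\<in>D. (\<forall>\<eta>\<in>D. \<Omega> \<xi> \<eta> + \<Upsilon> \<xi> \<eta> = 0) \<longrightarrow> \<xi> = 0) \<and>
        (\<forall>\<Lambda>\<in>conj_dual_on D N. \<exists>\<xi>\<in>D. \<forall>\<eta>\<in>D. \<Lambda> \<eta> = \<Omega> \<xi> \<eta> + \<Upsilon> \<xi> \<eta>)}"

definition solvable ::
    "'a::complex_inner set \<Rightarrow> ('a \<Rightarrow> real) \<Rightarrow> ('a \<Rightarrow> 'a \<Rightarrow> complex) \<Rightarrow> bool" where
  "solvable D N \<Omega> \<longleftrightarrow> q_closed D N \<Omega> \<and> perturbations D N \<Omega> \<noteq> {}"

end

theory Submission
  imports Defs
begin

text \<open>Both conditions say that \<open>\<D>\<close> is a Hilbert space, continuously embedded in \<open>\<H>\<close>, on which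
  \<open>\<Omega>\<close> is bounded. By the Riesz theorem the form \<open>\<Omega> - \<lambda>\<iota>\<close> is represented by a bounded operator
  \<open>C\<close> on it; \<open>C\<close> is injective iff \<open>-\<lambda>\<iota>\<close> satisfies (i), and surjective iff it satisfies (ii).
  The remaining parts of q-closedness come for free: Hilbert spaces are reflexive, and (2) follows
  from the continuity of the embedding and completeness.\<close>

section \<open>Inner products on a subspace: Cauchy-Schwarz and the induced norm\<close>

locale inner_product_space_on =
  fixes D :: "'a::complex_vector set" and ip :: "'a \<Rightarrow> 'a \<Rightarrow> complex"
  assumes subspace: "complex_vector.subspace D"
    and inner_product: "inner_product_on D ip"
begin

abbreviation N :: "'a \<Rightarrow> real" where "N \<equiv> ip_norm ip"

lemma mem [simp]:
  "0 \<in> D"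
  "x \<in> D \<Longrightarrow> y \<in> D \<Longrightarrow> x + y \<in> D"
  "x \<in> D \<Longrightarrow> y \<in> D \<Longrightarrow> x - y \<in> D"
  "x \<in> D \<Longrightarrow> c *\<^sub>C x \<in> D"
  using subspace
  by (auto intro: complex_vector.subspace_0 complex_vector.subspace_add
      complex_vector.subspace_diff complex_vector.subspace_scale)

lemma ip_add_left: "x \<in> D \<Longrightarrow> y \<in> D \<Longrightarrow> z \<in> D \<Longrightarrow> ip (x + y) z = ip x z + ip y z"
  and ip_scale_left: "x \<in> D \<Longrightarrow> z \<in> D \<Longrightarrow> ip (c *\<^sub>C x) z = c * ip x z"
  and ip_add_right: "x \<in> D \<Longrightarrow> y \<in> D \<Longrightarrow> z \<in> D \<Longrightarrow> ip z (x + y) = ip z x + ip z y"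
  and ip_scale_right: "x \<in> D \<Longrightarrow> z \<in> D \<Longrightarrow> ip z (c *\<^sub>C x) = cnj c * ip z x"
  using inner_product[unfolded inner_product_on_def, THEN conjunct1]
  by (simp_all add: sesquilinear_on_def clinear_on_def antilinear_on_def scaleC_complex_def)

lemma ip_commute: "x \<in> D \<Longrightarrow> y \<in> D \<Longrightarrow> ip y x = cnj (ip x y)"
  and ip_ge_zero: "x \<in> D \<Longrightarrow> 0 \<le> Re (ip x x)"
  and ip_eq_zero_iff: "x \<in> D \<Longrightarrow> ip x x = 0 \<longleftrightarrow> x = 0"
  by (rule inner_product[unfolded inner_product_on_def, THEN conjunct2, THEN conjunct1, rule_format]
      inner_product[unfolded inner_product_on_def, THEN conjunct2, THEN conjunct2, THEN conjunct1,
        rule_format]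
      inner_product[unfolded inner_product_on_def, THEN conjunct2, THEN conjunct2, THEN conjunct2,
        rule_format]; assumption)+

lemma diff_conv_scaleC: "x - y = x + (-1) *\<^sub>C y" for x y :: 'a
  by (simp add: complex_vector.scale_minus_left scaleC_one)

lemma ip_diff_left: "x \<in> D \<Longrightarrow> y \<in> D \<Longrightarrow> z \<in> D \<Longrightarrow> ip (x - y) z = ip x z - ip y z"
  by (simp only: diff_conv_scaleC ip_add_left ip_scale_left mem) simp

lemma ip_zero_left: "x \<in> D \<Longrightarrow> ip 0 x = 0"
  using ip_diff_left[of x x x] by simp

lemma ip_zero_right: "x \<in> D \<Longrightarrow> ip x 0 = 0"
  using ip_commute[of 0 x] ip_zero_left[of x] by simp

lemma N_nonneg [simp]: "x \<in> D \<Longrightarrow> 0 \<le> N x"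
  by (simp add: ip_norm_def ip_ge_zero)

lemma N_square: "x \<in> D \<Longrightarrow> (N x)\<^sup>2 = Re (ip x x)"
  by (simp add: ip_norm_def ip_ge_zero)

text \<open>Hermitian symmetry makes \<open>ip x x\<close> real, so the norm, which only records the
  real part, determines it completely.\<close>

lemma ip_self: "x \<in> D \<Longrightarrow> ip x x = complex_of_real ((N x)\<^sup>2)"
  using arg_cong[OF ip_commute[of x x], of Im] by (simp add: N_square complex_eq_iff)

lemma N_eq_zero_iff: "x \<in> D \<Longrightarrow> N x = 0 \<longleftrightarrow> x = 0"
  using ip_eq_zero_iff[of x] ip_self[of x] by simp

lemma N_scale: "x \<in> D \<Longrightarrow> N (c *\<^sub>C x) = cmod c * N x"
proof -
  assume x: "x \<in> D"
  have "ip (c *\<^sub>C x) (c *\<^sub>C x) = (c * cnj c) * ip x x"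
    using x by (simp add: ip_scale_left ip_scale_right)
  also have "\<dots> = complex_of_real ((cmod c * N x)\<^sup>2)"
    using x by (simp only: ip_self complex_norm_square[symmetric]) (simp add: power_mult_distrib)
  finally have "(N (c *\<^sub>C x))\<^sup>2 = (cmod c * N x)\<^sup>2"
    using x by (simp only: N_square mem Re_complex_of_real)
  then show ?thesis
    using x by (simp add: power2_eq_iff_nonneg)
qed

lemma N_add_square:
  assumes "x \<in> D" "y \<in> D"
  shows "(N (x + y))\<^sup>2 = (N x)\<^sup>2 + 2 * Re (ip x y) + (N y)\<^sup>2"
  using assms ip_commute[of x y] by (simp add: N_square ip_add_left ip_add_right)

lemma Re_ip_le:
  assumes "x \<in> D" "y \<in> D"
  shows "Re (ip x y) \<le> N x * N y"
proof (cases "x = 0 \<or> y = 0")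
  case True
  then show ?thesis
    using assms by (auto simp: ip_zero_left ip_zero_right)
next
  case False
  then have pos: "0 < N x" "0 < N y"
    using assms N_eq_zero_iff N_nonneg by (metis less_eq_real_def)+
  \<comment> \<open>The coefficients have the lengths \<open>N y\<close> and \<open>N x\<close>, so
    both summands get norm \<open>N x * N y\<close> and the expansion factorises. Cancelling the
    factor \<open>N x * N y\<close> is where both vectors must be nonzero.\<close>
  have "0 \<le> (N (of_real (N y) *\<^sub>C x + of_real (- N x) *\<^sub>C y))\<^sup>2"
    by simp
  also have "\<dots> = 2 * (N x * N y) * (N x * N y - Re (ip x y))"
    using assms
    by (subst N_add_square)
      (simp_all del: of_real_minus
        add: N_scale ip_scale_left ip_scale_right, simp add: algebra_simps power2_eq_square)
  finally have "0 \<le> 2 * (N x * N y) * (N x * N y - Re (ip x y))" .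
  then show ?thesis
    using pos by (auto simp: zero_le_mult_iff mult_le_0_iff)
qed

lemma Cauchy_Schwarz:
  assumes "x \<in> D" "y \<in> D"
  shows "cmod (ip x y) \<le> N x * N y"
proof (cases "ip x y = 0")
  case False
  \<comment> \<open>Multiplying \<open>x\<close> by this phase preserves its norm and turns
    \<open>ip x y\<close> into its modulus, so the bound on real parts gives the bound on
    moduli.\<close>
  define c where "c = cnj (ip x y) / cmod (ip x y)"
  have "cmod c = 1"
    using False by (simp add: c_def norm_divide)
  moreover have "c * ip x y = of_real (cmod (ip x y))"
    using False complex_norm_square[of "ip x y"]
    by (simp add: c_def field_simps power2_eq_square)
  ultimately show ?thesis
    using Re_ip_le[of "c *\<^sub>C x" y] assms by (simp add: ip_scale_left N_scale)
qed (use assms in simp)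

lemma N_triangle:
  assumes "x \<in> D" "y \<in> D"
  shows "N (x + y) \<le> N x + N y"
proof (rule power2_le_imp_le)
  show "(N (x + y))\<^sup>2 \<le> (N x + N y)\<^sup>2"
    using Re_ip_le[OF assms] assms by (simp add: N_add_square power2_sum)
qed (use assms in simp)

lemma norm_on_N: "norm_on D N"
  by (auto simp: norm_on_def N_eq_zero_iff N_scale N_triangle)

lemma N_minus_commute: "x \<in> D \<Longrightarrow> y \<in> D \<Longrightarrow> N (x - y) = N (y - x)"
  using N_scale[of "x - y" "-1"] by (simp add: complex_vector.scale_minus_left scaleC_one)

lemma N_triangle_reverse:
  assumes "x \<in> D" "y \<in> D"
  shows "\<bar>N x - N y\<bar> \<le> N (x - y)"
  using N_triangle[of "x - y" y] N_triangle[of "y - x" x] N_minus_commute[of x y] assms by simp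

section \<open>The induced metric and the Riesz representation theorem\<close>

sublocale Metric_space D "norm_dist D N"
proof
  show "norm_dist D N x z \<le> norm_dist D N x y + norm_dist D N y z"
    if "x \<in> D" "y \<in> D" "z \<in> D" for x y z
    using N_triangle[of "x - y" "y - z"] that by (simp add: norm_dist_def)
qed (auto simp: norm_dist_def N_eq_zero_iff N_minus_commute)

lemma MCauchy_iff:
  "MCauchy X \<longleftrightarrow> range X \<subseteq> D \<and> (\<forall>e>0. \<exists>n0. \<forall>m\<ge>n0. \<forall>n\<ge>n0. N (X m - X n) < e)"
proof (cases "range X \<subseteq> D")
  case True
  then have "X n \<in> D" for n by auto
  with True show ?thesis
    by (simp add: MCauchy_def norm_dist_def)
qed (simp add: MCauchy_def)

lemma limitin_mtopology_iff:
  assumes "range X \<subseteq> D"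
  shows "limitin mtopology X x sequentially \<longleftrightarrow> x \<in> D \<and> (\<lambda>n. N (X n - x)) \<longlonglongrightarrow> 0"
proof -
  have "X n \<in> D" for n
    using assms by auto
  then show ?thesis
    by (cases "x \<in> D") (simp_all add: limitin_metric_dist_null norm_dist_def)
qed

text \<open>The representing vector minimises \<open>J\<close>; minimising sequences are Cauchy by the
  parallelogram law.\<close>

lemma Riesz_representation:
  assumes complete: "mcomplete"
    and anti: "antilinear_on D L"
    and bound: "\<forall>x\<in>D. cmod (L x) \<le> K * N x"
  obtains x where "x \<in> D" "\<And>y. y \<in> D \<Longrightarrow> L y = ip x y"
proof -
  have L_add: "L (x + y) = L x + L y" if "x \<in> D" "y \<in> D" for x y
    using anti that by (simp add: antilinear_on_def)
  have L_scale: "L (c *\<^sub>C x) = cnj c * L x" if "x \<in> D" for x c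
    using anti that by (simp add: antilinear_on_def scaleC_complex_def)
  have L_diff: "L (x - y) = L x - L y" if "x \<in> D" "y \<in> D" for x y
    using that by (simp only: diff_conv_scaleC L_add L_scale mem) simp
  \<comment> \<open>If \<open>L\<close> is represented by \<open>z\<close>, then \<open>J x\<close>
    is \<open>(N (x - z))\<^sup>2 - (N z)\<^sup>2\<close>, so the vector sought is the one at which
    \<open>J\<close> is least.\<close>
  define J where "J x = (N x)\<^sup>2 - 2 * Re (L x)" for x
  define m where "m = Inf (J ` D)"
  \<comment> \<open>Completing the square: \<open>J x\<close> is at least
    \<open>(N x - K)\<^sup>2 - K\<^sup>2\<close>.\<close>
  have "- K\<^sup>2 \<le> J x" if "x \<in> D" for x
  proof -
    have "Re (L x) \<le> K * N x"
      using bound that complex_Re_le_cmod order_trans by blast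
    moreover have "0 \<le> (N x - K)\<^sup>2"
      by simp
    ultimately show ?thesis
      by (simp add: J_def power2_diff algebra_simps)
  qed
  then have bdd: "bdd_below (J ` D)"
    by (auto simp: bdd_below_def)
  have m_le: "m \<le> J x" if "x \<in> D" for x
    unfolding m_def using bdd that by (rule cINF_lower)
  have "\<exists>x\<in>D. J x < m + inverse (Suc n)" for n
  proof -
    have "Inf (J ` D) < m + inverse (Suc n)"
      by (simp add: m_def)
    then show ?thesis
      using bdd by (subst (asm) cINF_less_iff) (auto intro: mem(1))
  qed
  then obtain X where X: "\<And>n. X n \<in> D" "\<And>n. J (X n) < m + inverse (Suc n)"
    by metis
  \<comment> \<open>With \<open>z\<close> the midpoint of \<open>x\<close> and \<open>y\<close>, the
    parallelogram law reads \<open>(N (x - y))\<^sup>2 = 2 * J x + 2 * J y - 4 * J z\<close>, the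
    contributions of \<open>L\<close> cancelling; then \<open>m \<le> J z\<close> is
    inserted.\<close>
  have parallelogram: "(N (x - y))\<^sup>2 \<le> 2 * (J x - m) + 2 * (J y - m)" if "x \<in> D" "y \<in> D" for x y
  proof -
    define z where "z = of_real (1/2) *\<^sub>C (x + y)"
    have "z \<in> D"
      using that by (simp add: z_def)
    moreover have "J z = (N (x + y))\<^sup>2 / 4 - Re (L x) - Re (L y)"
      using that unfolding J_def z_def
      by (simp only: N_scale L_scale mem L_add) (simp add: norm_divide power2_eq_square add_divide_distrib)
    moreover have "(N (x - y))\<^sup>2 = (N x)\<^sup>2 - 2 * Re (ip x y) + (N y)\<^sup>2"
      using that N_add_square[of x "(-1) *\<^sub>C y"]
      by (simp only: diff_conv_scaleC[symmetric] ip_scale_right N_scale mem) simp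
    ultimately show ?thesis
      using m_le[of z] N_add_square[OF that] unfolding J_def by (simp add: field_simps)
  qed
  have "MCauchy X"
    unfolding MCauchy_iff
  proof (intro conjI allI impI)
    fix e :: real
    assume "0 < e"
    \<comment> \<open>The quarter absorbs the coefficients of the previous estimate: beyond
      \<open>n0\<close> both excesses over \<open>m\<close> are below \<open>e\<^sup>2 / 4\<close>,
      and twice their sum is below \<open>e\<^sup>2\<close>.\<close>
    then obtain n0 where n0: "inverse (Suc n0) < e\<^sup>2 / 4"
      using reals_Archimedean[of "e\<^sup>2 / 4"] by auto
    have "N (X i - X j) < e" if "n0 \<le> i" "n0 \<le> j" for i j
    proof (rule power2_less_imp_less)
      have "inverse (Suc i) \<le> inverse (Suc n0)" "inverse (Suc j) \<le> inverse (Suc n0)"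
        using that by (simp_all add: field_simps)
      then show "(N (X i - X j))\<^sup>2 < e\<^sup>2"
        using parallelogram[OF X(1)[of i] X(1)[of j]] X(2)[of i] X(2)[of j] n0 by argo
    qed (use \<open>0 < e\<close> in simp)
    then show "\<exists>n0. \<forall>i\<ge>n0. \<forall>j\<ge>n0. N (X i - X j) < e"
      by blast
  qed (use X in auto)
  moreover have range: "range X \<subseteq> D"
    using X by auto
  ultimately obtain x where x: "x \<in> D" and lim: "(\<lambda>n. N (X n - x)) \<longlonglongrightarrow> 0"
    using complete limitin_mtopology_iff unfolding mcomplete_def by metis
  \<comment> \<open>\<open>N\<close> and \<open>L\<close> are both controlled by the distance
    \<open>N (X n - x)\<close>, so \<open>J\<close> passes to the limit and \<open>x\<close> attains
    the infimum.\<close>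
  have "(\<lambda>n. N (X n) - N x) \<longlonglongrightarrow> 0"
    by (rule Lim_null_comparison[OF _ lim]) (simp add: N_triangle_reverse X x)
  then have N_lim: "(\<lambda>n. N (X n)) \<longlonglongrightarrow> N x"
    by (simp add: LIM_zero_iff)
  have "(\<lambda>n. L (X n) - L x) \<longlonglongrightarrow> 0"
  proof (rule Lim_null_comparison)
    show "\<forall>\<^sub>F n in sequentially. norm (L (X n) - L x) \<le> K * N (X n - x)"
      using bound X x by (simp add: L_diff[symmetric])
    show "(\<lambda>n. K * N (X n - x)) \<longlonglongrightarrow> 0"
      using tendsto_mult_right_zero[OF lim] .
  qed
  then have L_lim: "(\<lambda>n. L (X n)) \<longlonglongrightarrow> L x"
    by (simp add: LIM_zero_iff)
  have J_lim: "(\<lambda>n. J (X n)) \<longlonglongrightarrow> J x"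
    unfolding J_def by (intro tendsto_intros N_lim L_lim)
  have "(\<lambda>n. m + inverse (Suc n)) \<longlonglongrightarrow> m + 0"
    by (intro tendsto_intros LIMSEQ_inverse_real_of_nat)
  with J_lim have "J x \<le> m + 0"
    by (rule LIMSEQ_le) (use X(2) less_imp_le in blast)
  then have minimal: "J x \<le> J y" if "y \<in> D" for y
    using m_le[OF that] by simp
  have Re_eq: "Re (L y) = Re (ip x y)" if y: "y \<in> D" for y
  proof (rule ccontr)
    define d where "d = Re (ip x y) - Re (L y)"
    define a where "a = (N y)\<^sup>2"
    \<comment> \<open>Along the line through \<open>x\<close> in direction \<open>y\<close>,
      \<open>J\<close> changes by \<open>t\<^sup>2 * a + 2 * t * d\<close>. Its minimum would be at
      \<open>- d / a\<close>; using \<open>a + 1\<close> avoids division by zero and still makes the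
      change negative when \<open>d\<close> is nonzero.\<close>
    define t where "t = - d / (a + 1)"
    assume "Re (L y) \<noteq> Re (ip x y)"
    then have "d \<noteq> 0"
      by (simp add: d_def)
    have "0 \<le> a"
      by (simp add: a_def)
    have "J (x + of_real t *\<^sub>C y) = J x + t\<^sup>2 * a + 2 * t * d"
      using x y unfolding J_def
      by (simp add: N_add_square N_scale L_add L_scale ip_scale_right a_def d_def
          power_mult_distrib algebra_simps)
    then have "0 \<le> t\<^sup>2 * a + 2 * t * d"
      using minimal[of "x + of_real t *\<^sub>C y"] x y by simp
    also have "\<dots> = - d\<^sup>2 * (a + 2) / (a + 1)\<^sup>2"
      using \<open>0 \<le> a\<close> by (simp add: t_def divide_simps power2_eq_square) (simp add: algebra_simps)
    also have "\<dots> < 0"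
      using \<open>0 \<le> a\<close> \<open>d \<noteq> 0\<close> by (simp add: divide_less_0_iff mult_pos_pos)
    finally show False
      by simp
  qed
  \<comment> \<open>The real parts at \<open>\<i> *\<^sub>C y\<close> are the imaginary parts at
    \<open>y\<close>, since both sides are conjugate linear in \<open>y\<close>.\<close>
  have "L y = ip x y" if y: "y \<in> D" for y
    using Re_eq[OF y] Re_eq[of "\<i> *\<^sub>C y"] x y by (simp add: L_scale ip_scale_right complex_eq_iff)
  then show ?thesis
    using that x by blast
qed

section \<open>Nondegeneracy and reflexivity\<close>

lemma eq_zeroI: "x \<in> D \<Longrightarrow> (\<And>y. y \<in> D \<Longrightarrow> ip x y = 0) \<Longrightarrow> x = 0"
  using ip_eq_zero_iff by blast

lemma eqI: "x \<in> D \<Longrightarrow> y \<in> D \<Longrightarrow> (\<And>z. z \<in> D \<Longrightarrow> ip x z = ip y z) \<Longrightarrow> x = y"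
  using eq_zeroI[of "x - y"] by (simp add: ip_diff_left)

text \<open>Riesz is used twice. The map sending \<open>y\<close> to \<open>F (p y)\<close> is
  bounded and conjugate linear, hence equal to \<open>ip x\<close> for some \<open>x\<close>. Every
  \<open>f\<close> in the dual is some \<open>p y\<close>, by Riesz for the complex conjugate of
  \<open>f\<close>, so \<open>F f = ip x y = f x\<close>.\<close>

lemma reflexive:
  assumes complete: "mcomplete"
  shows "reflexive_on D N"
  unfolding reflexive_on_def
proof
  fix F
  assume "F \<in> dual_on (dual_on D N) (dual_norm D N)"
  then obtain K where F: "clinear_on (dual_on D N) F"
    and K: "\<And>f. f \<in> dual_on D N \<Longrightarrow> cmod (F f) \<le> K * dual_norm D N f"
    by (auto simp: dual_on_def)
  \<comment> \<open>The value 0 off \<open>D\<close> is the normalisation in \<open>dual_on\<close>;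
    with it, conjugate linearity of \<open>p\<close> holds as an identity between functions.\<close>
  define p where "p y x = (if x \<in> D then ip x y else 0)" for y x
  have p_dual: "p y \<in> dual_on D N" if "y \<in> D" for y
  proof -
    have "clinear_on D (p y)"
      using that by (simp add: clinear_on_def p_def ip_add_left ip_scale_left scaleC_complex_def)
    moreover have "\<forall>x\<in>D. cmod (p y x) \<le> N y * N x"
      using that by (simp add: p_def Cauchy_Schwarz mult.commute)
    ultimately show ?thesis
      by (auto simp: dual_on_def p_def)
  qed
  \<comment> \<open>The upper bound transfers boundedness from \<open>F\<close> to its composition
    with \<open>p\<close>. Nonnegativity allows \<open>K\<close>, whose sign is unknown, to be
    replaced by \<open>\<bar>K\<bar>\<close>.\<close>
  have p_norm: "0 \<le> dual_norm D N (p y) \<and> dual_norm D N (p y) \<le> N y" if y: "y \<in> D" for y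
  proof
    have zero: "0 \<in> {x \<in> D. N x \<le> 1}"
      using N_eq_zero_iff[of 0] by simp
    have le: "cmod (p y x) \<le> N y" if "x \<in> {x \<in> D. N x \<le> 1}" for x
      using that y Cauchy_Schwarz[of x y] mult_right_mono[of "N x" 1 "N y"] by (simp add: p_def)
    show "dual_norm D N (p y) \<le> N y"
      unfolding dual_norm_def using zero le by (intro cSUP_least) blast+
    have "bdd_above ((\<lambda>x. cmod (p y x)) ` {x \<in> D. N x \<le> 1})"
      using le by (auto simp: bdd_above_def)
    from cSUP_upper[OF zero this] show "0 \<le> dual_norm D N (p y)"
      unfolding dual_norm_def by (rule order_trans[rotated]) simp
  qed
  have "p (x + y) = p x + p y" if "x \<in> D" "y \<in> D" for x y
    using that by (auto simp: p_def ip_add_right)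
  moreover have "p (c *\<^sub>C x) = cnj c *\<^sub>C p x" if "x \<in> D" for c x
    using that by (auto simp: p_def ip_scale_right scaleC_fun_def scaleC_complex_def)
  ultimately have "antilinear_on D (\<lambda>y. F (p y))"
    using F p_dual by (auto simp: antilinear_on_def clinear_on_def)
  moreover have "\<forall>y\<in>D. cmod (F (p y)) \<le> \<bar>K\<bar> * N y"
  proof
    fix y
    assume y: "y \<in> D"
    have "cmod (F (p y)) \<le> K * dual_norm D N (p y)"
      by (rule K[OF p_dual[OF y]])
    also have "\<dots> \<le> \<bar>K\<bar> * N y"
      using p_norm[OF y] by (intro mult_mono) auto
    finally show "cmod (F (p y)) \<le> \<bar>K\<bar> * N y" .
  qed
  ultimately obtain x where x: "x \<in> D" "\<And>y. y \<in> D \<Longrightarrow> F (p y) = ip x y"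
    by (rule Riesz_representation[OF complete]) blast
  have "F f = f x" if f: "f \<in> dual_on D N" for f
  proof -
    obtain M where "clinear_on D f" and M: "\<forall>x\<in>D. cmod (f x) \<le> M * N x"
      and outside: "\<And>x. x \<notin> D \<Longrightarrow> f x = 0"
      using f by (auto simp: dual_on_def)
    then have "antilinear_on D (\<lambda>x. cnj (f x))"
      by (simp add: clinear_on_def antilinear_on_def scaleC_complex_def)
    moreover have "\<forall>x\<in>D. cmod (cnj (f x)) \<le> M * N x"
      using M by simp
    ultimately obtain y where y: "y \<in> D" "\<And>z. z \<in> D \<Longrightarrow> cnj (f z) = ip y z"
      by (rule Riesz_representation[OF complete]) blast
    have "f z = p y z" for z
    proof (cases "z \<in> D")
      case True
      then show ?thesis
        using y(2)[of z] ip_commute[of y z] y(1) by (simp add: p_def flip: y(2))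
    qed (simp add: outside p_def)
    then have "f = p y"
      by blast
    with x y show ?thesis
      by (simp add: p_def)
  qed
  with x show "\<exists>x\<in>D. \<forall>f\<in>dual_on D N. F f = f x"
    by blast
qed

end

section \<open>The ambient inner product as the case \<open>D = UNIV\<close>, and its scalar
  multiples\<close>

lemma cinner_space: "inner_product_space_on UNIV (cinner :: 'a::complex_inner \<Rightarrow> 'a \<Rightarrow> complex)"
proof
  have right: "cinner x (y + z) = cinner x y + cinner x z"
    "cinner x (c *\<^sub>C y) = cnj c * cinner x y" for x y z :: 'a and c
    by (subst cinner_commute,
        simp add: cinner_add_left cinner_scaleC_left cinner_commute[symmetric])+
  show "inner_product_on UNIV (cinner :: 'a \<Rightarrow> 'a \<Rightarrow> complex)"
    by (simp add: inner_product_on_def sesquilinear_on_def clinear_on_def antilinear_on_def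
        cinner_add_left cinner_scaleC_left right scaleC_complex_def cinner_ge_zero
        cinner_eq_zero_iff flip: cinner_commute)
qed simp

lemma sesquilinear_on_cinner: "sesquilinear_on D (cinner :: 'a::complex_inner \<Rightarrow> 'a \<Rightarrow> complex)"
  using inner_product_space_on.inner_product[OF cinner_space,
      unfolded inner_product_on_def, THEN conjunct1]
  unfolding sesquilinear_on_def clinear_on_def antilinear_on_def by auto

lemma norm_cinner_le: "cmod (cinner x y) \<le> norm x * norm y"
  using inner_product_space_on.Cauchy_Schwarz[OF cinner_space, of x y]
  by (simp add: ip_norm_def norm_eq_sqrt_cinner)

lemma norm_scaleC: "norm (c *\<^sub>C x) = cmod c * norm (x :: 'a::complex_inner)"
  using inner_product_space_on.N_scale[OF cinner_space, of x c]
  by (simp add: ip_norm_def norm_eq_sqrt_cinner)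

lemma sesquilinear_on_scale_cinner:
  "sesquilinear_on UNIV (\<lambda>x y :: 'a::complex_inner. c * cinner x y)"
  using sesquilinear_on_cinner[of "UNIV :: 'a set"]
  by (simp add: sesquilinear_on_def clinear_on_def antilinear_on_def scaleC_complex_def
      algebra_simps)

lemma bounded_form_on_scale_cinner:
  "bounded_form_on UNIV norm (\<lambda>x y :: 'a::complex_inner. c * cinner x y)"
proof -
  \<comment> \<open>The added 1 keeps the constant strictly positive for \<open>c = 0\<close>, as
    \<open>bounded_form_on\<close> demands.\<close>
  have "cmod (c * cinner x y) \<le> (cmod c + 1) * norm x * norm y" for x y :: 'a
  proof -
    have "cmod (c * cinner x y) \<le> cmod c * (norm x * norm y)"
      by (simp add: norm_mult mult_left_mono norm_cinner_le)
    also have "\<dots> \<le> (cmod c + 1) * (norm x * norm y)"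
      by (intro mult_right_mono) auto
    finally show ?thesis
      by (simp add: mult.assoc)
  qed
  then show ?thesis
    unfolding bounded_form_on_def by (intro exI[of _ "cmod c + 1"]) (simp add: add_nonneg_pos)
qed

section \<open>Continuity of the embedding and q-closedness\<close>

lemma continuous_embedding_iff:
  fixes D :: "'a::complex_inner set"
  assumes "inner_product_space_on D ip"
  shows "continuous_map (Metric_space.mtopology D (norm_dist D (ip_norm ip))) euclidean (\<lambda>\<xi>. \<xi>)
    \<longleftrightarrow> (\<exists>\<alpha>>0. \<forall>\<xi>\<in>D. norm \<xi> \<le> \<alpha> * ip_norm ip \<xi>)"
proof -
  interpret inner_product_space_on D ip by fact
  show ?thesis
  proof
    assume "continuous_map mtopology euclidean (\<lambda>\<xi>. \<xi>)"
    \<comment> \<open>Continuity at 0 suffices: the preimage of the unit ball contains some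
      \<open>mball 0 r\<close>, and homogeneity spreads this bound to all of
      \<open>D\<close>.\<close>
    then have "openin mtopology {\<xi> \<in> topspace mtopology. \<xi> \<in> ball 0 1}"
      by (rule openin_continuous_map_preimage) (simp add: open_openin[symmetric])
    then have "openin mtopology {\<xi> \<in> D. norm \<xi> < 1}"
      by simp
    moreover have "0 \<in> {\<xi> \<in> D. norm \<xi> < 1}"
      by simp
    ultimately obtain r where r: "0 < r" "mball 0 r \<subseteq> {\<xi> \<in> D. norm \<xi> < 1}"
      unfolding openin_mtopology by blast
    have small: "norm \<xi> < 1" if "\<xi> \<in> D" "N \<xi> < r" for \<xi>
    proof -
      have "\<xi> \<in> mball 0 r"
        using that N_minus_commute[of 0 \<xi>] by (simp add: in_mball norm_dist_def)
      with r show ?thesis by blast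
    qed
    have "norm \<xi> \<le> (2 / r) * N \<xi>" if \<xi>: "\<xi> \<in> D" for \<xi>
    proof (cases "\<xi> = 0")
      case False
      then have pos: "0 < N \<xi>"
        using \<xi> N_eq_zero_iff[of \<xi>] N_nonneg[of \<xi>] by linarith
      \<comment> \<open>Scaling by \<open>s\<close> brings \<open>\<xi>\<close> to
        \<open>N\<close>-norm \<open>r / 2\<close>, inside the ball of radius \<open>r\<close>;
        undoing the scaling produces the constant \<open>2 / r\<close>.\<close>
      define s where "s = r / (2 * N \<xi>)"
      have s: "0 < s"
        using pos r by (simp add: s_def)
      have "N (of_real s *\<^sub>C \<xi>) < r"
        using s pos r \<xi> by (simp add: N_scale) (simp add: s_def)
      then have "norm (of_real s *\<^sub>C \<xi>) < 1"
        using small \<xi> by simp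
      then have "s * norm \<xi> < 1"
        using s by (simp add: norm_scaleC)
      then show ?thesis
        using pos r by (simp add: s_def field_simps)
    qed (use N_eq_zero_iff[of 0] in simp)
    then show "\<exists>\<alpha>>0. \<forall>\<xi>\<in>D. norm \<xi> \<le> \<alpha> * N \<xi>"
      using r by (intro exI[of _ "2 / r"]) simp
  next
    assume "\<exists>\<alpha>>0. \<forall>\<xi>\<in>D. norm \<xi> \<le> \<alpha> * N \<xi>"
    then obtain \<alpha> where \<alpha>: "0 < \<alpha>" "\<And>\<xi>. \<xi> \<in> D \<Longrightarrow> norm \<xi> \<le> \<alpha> * N \<xi>"
      by blast
    have "openin mtopology {\<xi> \<in> D. \<xi> \<in> U}" if "open U" for U :: "'a set"
      unfolding openin_mtopology
    proof (intro conjI allI impI)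
      fix x
      assume x: "x \<in> {\<xi> \<in> D. \<xi> \<in> U}"
      then obtain e where e: "0 < e" "ball x e \<subseteq> U"
        using \<open>open U\<close> open_contains_ball by blast
      have "mball x (e / \<alpha>) \<subseteq> {\<xi> \<in> D. \<xi> \<in> U}"
      proof
        fix y
        assume "y \<in> mball x (e / \<alpha>)"
        then have y: "y \<in> D" "N (x - y) < e / \<alpha>"
          using x by (auto simp: norm_dist_def)
        then have "norm (x - y) < e"
          using \<alpha>(1) \<alpha>(2)[of "x - y"] x by (simp add: field_simps)
        with e y show "y \<in> {\<xi> \<in> D. \<xi> \<in> U}"
          by (auto simp: dist_norm)
      qed
      then show "\<exists>r>0. mball x r \<subseteq> {\<xi> \<in> D. \<xi> \<in> U}"
        using e \<alpha>(1) by (intro exI[of _ "e / \<alpha>"]) simp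
    qed auto
    then show "continuous_map mtopology euclidean (\<lambda>\<xi>. \<xi>)"
      by (simp add: continuous_map open_openin[symmetric])
  qed
qed

text \<open>Reflexivity comes from Riesz. For the compatibility of the two norms, completeness gives
  an \<open>N\<close>-Cauchy sequence an \<open>N\<close>-limit in \<open>D\<close>; by the
  embedding this is also its ambient limit, so it is 0 whenever the sequence tends to 0 in the
  ambient norm.\<close>

lemma q_closed_ip_norm_iff:
  fixes D :: "'a::complex_inner set"
  assumes "complex_vector.subspace D" "inner_product_on D ip"
  shows "q_closed D (ip_norm ip) \<Omega> \<longleftrightarrow>
    Metric_space.mcomplete D (norm_dist D (ip_norm ip)) \<and>
    (\<exists>\<alpha>>0. \<forall>\<xi>\<in>D. norm \<xi> \<le> \<alpha> * ip_norm ip \<xi>) \<and> bounded_form_on D (ip_norm ip) \<Omega>"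
proof -
  interpret inner_product_space_on D ip
    using assms by unfold_locales
  have "(\<lambda>n. N (X n)) \<longlonglongrightarrow> 0"
    if complete: mcomplete and \<alpha>: "\<forall>\<xi>\<in>D. norm \<xi> \<le> \<alpha> * N \<xi>"
      and X: "MCauchy X" "(\<lambda>n. norm (X n)) \<longlonglongrightarrow> 0" for X \<alpha>
  proof -
    have range: "range X \<subseteq> D"
      using X(1) by (simp add: MCauchy_def)
    obtain x where x: "x \<in> D" "(\<lambda>n. N (X n - x)) \<longlonglongrightarrow> 0"
      using complete X(1) limitin_mtopology_iff[OF range] unfolding mcomplete_def by blast
    have "(\<lambda>n. X n - x) \<longlonglongrightarrow> 0"
    proof (rule Lim_null_comparison)
      show "\<forall>\<^sub>F n in sequentially. norm (X n - x) \<le> \<alpha> * N (X n - x)"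
        using \<alpha> range x(1) by (simp add: range_subsetD)
      show "(\<lambda>n. \<alpha> * N (X n - x)) \<longlonglongrightarrow> 0"
        using tendsto_mult_right_zero[OF x(2)] .
    qed
    then have "X \<longlonglongrightarrow> x"
      by (simp add: LIM_zero_iff)
    moreover have "X \<longlonglongrightarrow> 0"
      using X(2) by (simp add: tendsto_norm_zero_iff)
    ultimately have "x = 0"
      using LIMSEQ_unique by blast
    with x(2) show ?thesis
      by simp
  qed
  then show ?thesis
    unfolding q_closed_def banach_on_def
    using subspace norm_on_N reflexive by blast
qed

section \<open>The operator representing the shifted form\<close>

lemma represented_by_operator_iff:
  fixes D :: "'a::complex_inner set"
  assumes "complex_vector.subspace D" "inner_product_on D ip"
    and complete: "Metric_space.mcomplete D (norm_dist D (ip_norm ip))"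
    and sesqui: "sesquilinear_on D \<Omega>" and bounded: "bounded_form_on D (ip_norm ip) \<Omega>"
    and embedding: "\<forall>\<xi>\<in>D. norm \<xi> \<le> \<alpha> * ip_norm ip \<xi>"
  shows "(\<exists>C. bounded_operator_on D (ip_norm ip) C \<and> bij_betw C D D \<and>
      (\<forall>\<xi>\<in>D. \<forall>\<eta>\<in>D. \<Omega> \<xi> \<eta> - lam * cinner \<xi> \<eta> = ip (C \<xi>) \<eta>))
    \<longleftrightarrow> (\<lambda>\<xi> \<eta>. - lam * cinner \<xi> \<eta>) \<in> perturbations D (ip_norm ip) \<Omega>"
    (is "?op \<longleftrightarrow> ?pert")
proof -
  interpret inner_product_space_on D ip
    using assms by unfold_locales
  define S where "S \<xi> \<eta> = \<Omega> \<xi> \<eta> - lam * cinner \<xi> \<eta>" for \<xi> \<eta>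
  \<comment> \<open>A multiple of the ambient inner product is already a bounded sesquilinear form,
    so only the injectivity and surjectivity conditions remain.\<close>
  have pert_iff: "?pert \<longleftrightarrow> (\<forall>\<xi>\<in>D. (\<forall>\<eta>\<in>D. S \<xi> \<eta> = 0) \<longrightarrow> \<xi> = 0) \<and>
      (\<forall>\<Lambda>\<in>conj_dual_on D N. \<exists>\<xi>\<in>D. \<forall>\<eta>\<in>D. \<Lambda> \<eta> = S \<xi> \<eta>)"
    using sesquilinear_on_scale_cinner[where c = "- lam", where ?'a = 'a]
      bounded_form_on_scale_cinner[where c = "- lam", where ?'a = 'a]
    by (simp add: perturbations_def S_def)
  have S_antilinear: "antilinear_on D (S \<xi>)" if "\<xi> \<in> D" for \<xi>
    using that sesqui sesquilinear_on_cinner[of D]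
    by (simp add: S_def sesquilinear_on_def antilinear_on_def scaleC_complex_def algebra_simps)
  have S_linear: "clinear_on D (\<lambda>\<xi>. S \<xi> \<eta>)" if "\<eta> \<in> D" for \<eta>
    using that sesqui sesquilinear_on_cinner[of D]
    by (simp add: S_def sesquilinear_on_def clinear_on_def scaleC_complex_def algebra_simps)
  obtain \<beta> where \<beta>: "\<And>\<xi> \<eta>. \<xi> \<in> D \<Longrightarrow> \<eta> \<in> D \<Longrightarrow> cmod (\<Omega> \<xi> \<eta>) \<le> \<beta> * N \<xi> * N \<eta>"
    using bounded by (auto simp: bounded_form_on_def)
  \<comment> \<open>\<open>\<beta>\<close> bounds \<open>\<Omega>\<close>; the embedding constant
    enters once for each argument of \<open>cinner\<close>.\<close>
  define K where "K = \<beta> + cmod lam * (\<alpha> * \<alpha>)"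
  have S_bound: "cmod (S \<xi> \<eta>) \<le> K * N \<xi> * N \<eta>" if "\<xi> \<in> D" "\<eta> \<in> D" for \<xi> \<eta>
  proof -
    have "cmod (cinner \<xi> \<eta>) \<le> norm \<xi> * norm \<eta>"
      by (rule norm_cinner_le)
    also have "\<dots> \<le> (\<alpha> * N \<xi>) * (\<alpha> * N \<eta>)"
      using that embedding
      by (intro mult_mono) (auto intro: order_trans[OF norm_ge_zero])
    finally have "cmod (lam * cinner \<xi> \<eta>) \<le> cmod lam * ((\<alpha> * N \<xi>) * (\<alpha> * N \<eta>))"
      by (simp add: norm_mult mult_left_mono)
    moreover have "cmod (S \<xi> \<eta>) \<le> cmod (\<Omega> \<xi> \<eta>) + cmod (lam * cinner \<xi> \<eta>)"
      unfolding S_def by (rule norm_triangle_ineq4)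
    ultimately show ?thesis
      using \<beta>[OF that] by (simp add: K_def algebra_simps)
  qed
  have "\<exists>\<zeta>\<in>D. \<forall>\<eta>\<in>D. S \<xi> \<eta> = ip \<zeta> \<eta>" if \<xi>: "\<xi> \<in> D" for \<xi>
  proof -
    have "\<forall>\<eta>\<in>D. cmod (S \<xi> \<eta>) \<le> K * N \<xi> * N \<eta>"
      using S_bound \<xi> by blast
    then obtain \<zeta> where "\<zeta> \<in> D" "\<And>\<eta>. \<eta> \<in> D \<Longrightarrow> S \<xi> \<eta> = ip \<zeta> \<eta>"
      by (rule Riesz_representation[OF complete S_antilinear[OF \<xi>]]) blast
    then show ?thesis
      by blast
  qed
  \<comment> \<open>\<open>C \<xi>\<close> is the Riesz vector of \<open>S \<xi>\<close>. Both sides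
    of the equivalence will be compared with bijectivity of this one \<open>C\<close>.\<close>
  then obtain C where C: "\<And>\<xi>. \<xi> \<in> D \<Longrightarrow> C \<xi> \<in> D"
    and CS: "\<And>\<xi> \<eta>. \<xi> \<in> D \<Longrightarrow> \<eta> \<in> D \<Longrightarrow> S \<xi> \<eta> = ip (C \<xi>) \<eta>"
    by metis
  \<comment> \<open>Linearity of \<open>C\<close> is that of \<open>S\<close> in its first variable,
    read off by testing against all vectors of \<open>D\<close>.\<close>
  have C_add: "C (x + y) = C x + C y" if "x \<in> D" "y \<in> D" for x y
    using that S_linear C by (intro eqI) (auto simp: ip_add_left clinear_on_def simp flip: CS)
  have C_scale: "C (c *\<^sub>C x) = c *\<^sub>C C x" if "x \<in> D" for c x
    using that S_linear C
    by (intro eqI) (auto simp: ip_scale_left clinear_on_def scaleC_complex_def simp flip: CS)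
  have C_diff: "C (x - y) = C x - C y" if "x \<in> D" "y \<in> D" for x y
    using that by (simp only: diff_conv_scaleC C_add C_scale mem)
  \<comment> \<open>Testing \<open>S \<xi>\<close> against \<open>C \<xi>\<close> itself and
    cancelling one factor \<open>N (C \<xi>)\<close>. The absolute value makes the right-hand side
    nonnegative, which settles the case \<open>N (C \<xi>) = 0\<close>.\<close>
  have "N (C \<xi>) \<le> \<bar>K\<bar> * N \<xi>" if \<xi>: "\<xi> \<in> D" for \<xi>
  proof (cases "N (C \<xi>) = 0")
    case False
    have "N (C \<xi>) * N (C \<xi>) = cmod (ip (C \<xi>) (C \<xi>))"
      using C[OF \<xi>] by (simp only: ip_self norm_of_real) (simp add: power2_eq_square)
    also have "\<dots> \<le> K * N \<xi> * N (C \<xi>)"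
      using S_bound[OF \<xi> C[OF \<xi>]] CS[OF \<xi> C[OF \<xi>]] by simp
    finally have "N (C \<xi>) \<le> K * N \<xi>"
      using False N_nonneg[OF C[OF \<xi>]] by (simp add: mult_le_cancel_right)
    also have "\<dots> \<le> \<bar>K\<bar> * N \<xi>"
      using \<xi> by (simp add: mult_right_mono)
    finally show ?thesis .
  qed (use that in simp)
  then have C_bounded: "bounded_operator_on D N C"
    unfolding bounded_operator_on_def clinear_on_def using C C_add C_scale by blast
  \<comment> \<open>Nondegeneracy of \<open>ip\<close> forces any representing operator to agree
    with \<open>C\<close> on \<open>D\<close>, so the existential reduces to a property of
    \<open>C\<close>.\<close>
  have op_iff: "?op \<longleftrightarrow> bij_betw C D D"
  proof
    assume ?op
    then obtain B where B: "B ` D \<subseteq> D" "bij_betw B D D"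
      and BS: "\<And>\<xi> \<eta>. \<xi> \<in> D \<Longrightarrow> \<eta> \<in> D \<Longrightarrow> S \<xi> \<eta> = ip (B \<xi>) \<eta>"
      unfolding S_def bounded_operator_on_def by blast
    have "B \<xi> = C \<xi>" if "\<xi> \<in> D" for \<xi>
      using that B(1) C by (intro eqI) (auto simp flip: BS CS)
    with B(2) show "bij_betw C D D"
      by (metis bij_betw_cong)
  qed (use C_bounded CS in \<open>auto simp: S_def\<close>)
  have "C 0 = 0"
    using C_diff[of 0 0] by simp
  have "inj_on C D \<longleftrightarrow> (\<forall>\<xi>\<in>D. C \<xi> = 0 \<longrightarrow> \<xi> = 0)"
  proof
    assume "inj_on C D"
    then show "\<forall>\<xi>\<in>D. C \<xi> = 0 \<longrightarrow> \<xi> = 0"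
      using \<open>C 0 = 0\<close> by (auto dest: inj_onD[where y = 0])
  next
    assume ker: "\<forall>\<xi>\<in>D. C \<xi> = 0 \<longrightarrow> \<xi> = 0"
    show "inj_on C D"
    proof (rule inj_onI)
      fix x y
      assume "x \<in> D" "y \<in> D" "C x = C y"
      then show "x = y"
        using ker[rule_format, of "x - y"] by (simp add: C_diff)
    qed
  qed
  \<comment> \<open>The kernel of \<open>C\<close> is the left radical of \<open>S\<close>.\<close>
  also have "\<dots> \<longleftrightarrow> (\<forall>\<xi>\<in>D. (\<forall>\<eta>\<in>D. S \<xi> \<eta> = 0) \<longrightarrow> \<xi> = 0)"
  proof -
    have "C \<xi> = 0 \<longleftrightarrow> (\<forall>\<eta>\<in>D. S \<xi> \<eta> = 0)" if "\<xi> \<in> D" for \<xi>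
      using that C[OF that] eq_zeroI[OF C[OF that]] by (auto simp: CS ip_zero_left)
    then show ?thesis
      by simp
  qed
  finally have inj_iff: "inj_on C D \<longleftrightarrow> (\<forall>\<xi>\<in>D. (\<forall>\<eta>\<in>D. S \<xi> \<eta> = 0) \<longrightarrow> \<xi> = 0)" .
  \<comment> \<open>Riesz identifies the conjugate dual with \<open>D\<close> through
    \<open>ip\<close>; under this identification \<open>\<xi> \<mapsto> S \<xi>\<close> becomes
    \<open>C\<close>, so solving for every functional means hitting every vector.\<close>
  have surj_iff: "C ` D = D \<longleftrightarrow> (\<forall>\<Lambda>\<in>conj_dual_on D N. \<exists>\<xi>\<in>D. \<forall>\<eta>\<in>D. \<Lambda> \<eta> = S \<xi> \<eta>)"
  proof
    assume surj: "C ` D = D"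
    show "\<forall>\<Lambda>\<in>conj_dual_on D N. \<exists>\<xi>\<in>D. \<forall>\<eta>\<in>D. \<Lambda> \<eta> = S \<xi> \<eta>"
    proof
      fix \<Lambda>
      assume "\<Lambda> \<in> conj_dual_on D N"
      then obtain M where "antilinear_on D \<Lambda>" "\<forall>x\<in>D. cmod (\<Lambda> x) \<le> M * N x"
        by (auto simp: conj_dual_on_def)
      then obtain \<zeta> where \<zeta>: "\<zeta> \<in> D" "\<And>\<eta>. \<eta> \<in> D \<Longrightarrow> \<Lambda> \<eta> = ip \<zeta> \<eta>"
        by (rule Riesz_representation[OF complete]) blast
      then obtain \<xi> where "\<xi> \<in> D" "\<zeta> = C \<xi>"
        using surj by blast
      with \<zeta> show "\<exists>\<xi>\<in>D. \<forall>\<eta>\<in>D. \<Lambda> \<eta> = S \<xi> \<eta>"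
        by (auto simp: CS)
    qed
  next
    assume R: "\<forall>\<Lambda>\<in>conj_dual_on D N. \<exists>\<xi>\<in>D. \<forall>\<eta>\<in>D. \<Lambda> \<eta> = S \<xi> \<eta>"
    have "\<zeta> \<in> C ` D" if \<zeta>: "\<zeta> \<in> D" for \<zeta>
    proof -
      \<comment> \<open>Extension by 0 meets the normalisation of
        \<open>conj_dual_on\<close>.\<close>
      define \<Lambda> where "\<Lambda> \<eta> = (if \<eta> \<in> D then ip \<zeta> \<eta> else 0)" for \<eta>
      have "antilinear_on D \<Lambda>"
        using \<zeta> by (simp add: antilinear_on_def \<Lambda>_def ip_add_right ip_scale_right scaleC_complex_def)
      moreover have "\<forall>x\<in>D. cmod (\<Lambda> x) \<le> N \<zeta> * N x"
        using \<zeta> by (simp add: \<Lambda>_def Cauchy_Schwarz)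
      ultimately have "\<Lambda> \<in> conj_dual_on D N"
        by (auto simp: conj_dual_on_def \<Lambda>_def)
      with R obtain \<xi> where \<xi>: "\<xi> \<in> D" "\<forall>\<eta>\<in>D. \<Lambda> \<eta> = S \<xi> \<eta>"
        by blast
      then have "\<zeta> = C \<xi>"
        using \<zeta> C CS by (intro eqI) (auto simp: \<Lambda>_def)
      with \<xi> show ?thesis
        by blast
    qed
    then show "C ` D = D"
      using C by blast
  qed
  show ?thesis
    unfolding op_iff pert_iff unfolding bij_betw_def inj_iff surj_iff ..
qed

section \<open>McIntosh closedness and solvability, compared one inner product at a time\<close>

theorem theorem7p2:
  fixes D :: "'a::chilbert_space set" and \<Omega> :: "'a \<Rightarrow> 'a \<Rightarrow> complex"
  assumes "complex_vector.subspace D"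
    and "closure D = UNIV"
    and "sesquilinear_on D \<Omega>"
  shows "mcintosh_closed D \<Omega> \<longleftrightarrow>
    (\<exists>ip. inner_product_on D ip \<and> solvable D (ip_norm ip) \<Omega> \<and>
       (\<exists>lam. (\<lambda>\<xi> \<eta>. - lam * cinner \<xi> \<eta>) \<in> perturbations D (ip_norm ip) \<Omega>))"
proof -
  have "hilbert_on D ip \<and>
        continuous_map (Metric_space.mtopology D (norm_dist D (ip_norm ip))) euclidean (\<lambda>\<xi>. \<xi>) \<and>
        bounded_form_on D (ip_norm ip) \<Omega> \<and>
        (\<exists>lam C. bounded_operator_on D (ip_norm ip) C \<and> bij_betw C D D \<and>
           (\<forall>\<xi>\<in>D. \<forall>\<eta>\<in>D. \<Omega> \<xi> \<eta> - lam * cinner \<xi> \<eta> = ip (C \<xi>) \<eta>)) \<longleftrightarrow>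
      inner_product_on D ip \<and> solvable D (ip_norm ip) \<Omega> \<and>
        (\<exists>lam. (\<lambda>\<xi> \<eta>. - lam * cinner \<xi> \<eta>) \<in> perturbations D (ip_norm ip) \<Omega>)"
    (is "?mcintosh \<longleftrightarrow> ?solvable") for ip
  \<comment> \<open>Either side forces this condition on \<open>ip\<close>. Once it holds,
    completeness, the embedding bound and boundedness are available, and only the conditions
    involving \<open>lam\<close> remain to be matched.\<close>
  proof (cases "inner_product_on D ip \<and> q_closed D (ip_norm ip) \<Omega>")
    case True
    then have ip: "inner_product_on D ip" and q: "q_closed D (ip_norm ip) \<Omega>"
      by auto
    have space: "inner_product_space_on D ip"
      using assms(1) ip by unfold_locales
    obtain \<alpha> where complete: "Metric_space.mcomplete D (norm_dist D (ip_norm ip))"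
      and \<alpha>: "0 < \<alpha>" "\<forall>\<xi>\<in>D. norm \<xi> \<le> \<alpha> * ip_norm ip \<xi>"
      and bounded: "bounded_form_on D (ip_norm ip) \<Omega>"
      using q q_closed_ip_norm_iff[OF assms(1) ip] by auto
    note op_iff = represented_by_operator_iff[OF assms(1) ip complete assms(3) bounded \<alpha>(2)]
    show ?thesis
      \<comment> \<open>The same \<open>lam\<close> serves both sides, and its form witnesses that
        \<open>perturbations\<close> is nonempty.\<close>
      unfolding op_iff continuous_embedding_iff[OF space] hilbert_on_def solvable_def
      using assms(1) ip q complete \<alpha> bounded by blast
  next
    case False
    have "\<not> ?mcintosh"
    proof
      assume *: ?mcintosh
      then have ip: "inner_product_on D ip"
        by (simp add: hilbert_on_def)
      then have "inner_product_space_on D ip"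
        using assms(1) by unfold_locales
      from * ip have "q_closed D (ip_norm ip) \<Omega>"
        by (simp add: q_closed_ip_norm_iff[OF assms(1)] hilbert_on_def
            flip: continuous_embedding_iff[OF \<open>inner_product_space_on D ip\<close>])
      with ip False show False
        by simp
    qed
    with False show ?thesis
      unfolding solvable_def by blast
  qed
  then show ?thesis
    unfolding mcintosh_closed_def by simp
qed

end
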